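(* Let $S$ be a closed densely defined symmetric operator with infinite deficiency indices in a complex Hilbert space $\mathfrak H$. For $\lambda\in\mathbb C\setminus\mathbb R$ put $\mathfrak M_\lambda=\mathrm{ran}(S-\lambda I)$. (1) The following are equivalent: (i) $\mathrm{dom}\,S^2$ is dense in $\mathfrak H$ but is not a core of $S$; (ii) for at least one $\lambda\in\mathbb C\setminus\mathbb R$ (then for all such $\lambda$) the linear manifold $\mathfrak M_\lambda\cap\mathrm{dom}\,S$ is non-trivial and non-dense in $\mathfrak M_\lambda$, and $$P_{\mathfrak M_\lambda}(\mathrm{dom}\,S^* )\cap\bigl(\mathfrak M_\lambda\ominus(\mathfrak M_\lambda\cap\mathrm{dom}\,S)\bigr)=\{0\}.$$ (2) The following are equivalent: (i) $\mathrm{dom}\,S^2$ is non-trivial and non-dense in $\mathfrak H$; (ii) for at least one $\lambda\in\mathbb C\setminus\mathbb R$ (then for all such $\lambda$) the linear manifold $\mathfrak M_\lambda\cap\mathrm{dom}\,S$ is non-trivial and non-dense in $\mathfrak M_\lambda$, and $$P_{\mathfrak M_\lambda}(\mathrm{dom}\,S^* )\cap\bigl(\mathfrak M_\lambda\ominus(\mathfrak M_\lambda\cap\mathrm{dom}\,S)\bigr)\neq\{0\}.$$ Here "at least one (then for all)" means that the condition in (ii) holds for some $\lambda\in\mathbb C\setminus\mathbb R$ if and only if it holds for all of them.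
   Context: For a closed symmetric operator $S$ and $\lambda\in\mathbb C\setminus\mathbb R$ the range $\mathfrak M_\lambda=\mathrm{ran}(S-\lambda I)$ is a closed subspace. The deficiency subspaces are $\mathfrak N_\lambda=\mathfrak M_{\bar\lambda}^\perp$, and the deficiency indices are $n_+=\dim\mathfrak N_\lambda$ for $\mathrm{Im}\,\lambda>0$ and $n_-=\dim\mathfrak N_\lambda$ for $\mathrm{Im}\,\lambda<0$ (constant on each half-plane). $P_{\mathfrak L}$ is the orthogonal projection onto a closed subspace $\mathfrak L$; $\mathfrak M\ominus\mathcal N$ denotes the set of vectors of $\mathfrak M$ orthogonal to $\mathcal N$. A linear manifold is non-trivial if it is $\neq\{0\}$. $\mathrm{dom}\,S^2=\{f\in\mathrm{dom}\,S:Sf\in\mathrm{dom}\,S\}$. A core of a closed operator $S$ is a linear manifold in $\mathrm{dom}\,S$ that is dense in $\mathrm{dom}\,S$ with respect to the graph norm. *)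

theory Defs
  imports "HOL-Analysis.Analysis"
begin

text \<open>
  Complex Hilbert spaces extend \<^class>\<open>real_inner\<close>, so that norm, topology and completeness are the
  library's. The inner product is linear in its first argument; its real part is the
  underlying real inner product, which makes \<open>norm x\<close> the norm induced by \<open>cinner\<close>.
\<close>

class complex_inner = real_inner +
  fixes scaleC :: "complex \<Rightarrow> 'a \<Rightarrow> 'a" (infixr \<open>*\<^sub>C\<close> 75)
    and cinner :: "'a \<Rightarrow> 'a \<Rightarrow> complex"
  assumes scaleC_add_right: "a *\<^sub>C (x + y) = a *\<^sub>C x + a *\<^sub>C y"
    and scaleC_add_left: "(a + b) *\<^sub>C x = a *\<^sub>C x + b *\<^sub>C x"
    and scaleC_scaleC: "a *\<^sub>C (b *\<^sub>C x) = (a * b) *\<^sub>C x"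
    and scaleC_complex_of_real: "complex_of_real r *\<^sub>C x = r *\<^sub>R x"
    and cinner_commute: "cinner x y = cnj (cinner y x)"
    and cinner_add_left: "cinner (x + y) z = cinner x z + cinner y z"
    and cinner_scaleC_left: "cinner (a *\<^sub>C x) y = a * cinner x y"
    and Re_cinner: "Re (cinner x y) = inner x y"

class complex_hilbert = complex_inner + complete_space

lemma scaleC_one: "1 *\<^sub>C x = (x :: 'a :: complex_inner)"
  using scaleC_complex_of_real[of 1 x] by simp

global_interpretation complex_vector:
  vector_space "scaleC :: complex \<Rightarrow> 'a \<Rightarrow> 'a :: complex_inner"
  by unfold_locales (simp_all add: scaleC_add_right scaleC_add_left scaleC_scaleC scaleC_one)

lemma cinner_self: "cinner x x = complex_of_real ((norm (x :: 'a :: complex_inner))\<^sup>2)"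
proof (rule complex_eqI)
  show "Re (cinner x x) = Re (complex_of_real ((norm x)\<^sup>2))"
    by (simp add: Re_cinner power2_norm_eq_inner)
  have "Im (cinner x x) = - Im (cinner x x)"
    by (subst cinner_commute) simp
  then show "Im (cinner x x) = Im (complex_of_real ((norm x)\<^sup>2))"
    by simp
qed

instantiation complex :: complex_hilbert
begin

definition scaleC_complex :: "complex \<Rightarrow> complex \<Rightarrow> complex"
  where "scaleC_complex a x = a * x"

definition cinner_complex :: "complex \<Rightarrow> complex \<Rightarrow> complex"
  where "cinner_complex x y = x * cnj y"

instance
  by standard
    (simp_all add: scaleC_complex_def cinner_complex_def inner_complex_def algebra_simps
      scaleR_conv_of_real)

end

definition orth_complement :: "'a :: complex_inner set \<Rightarrow> 'a set"
  where "orth_complement X = {y. \<forall>x\<in>X. cinner x y = 0}"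

text \<open>Uniquely determined for closed subspaces \<open>L\<close> of a Hilbert space.\<close>

definition orth_proj :: "'a :: complex_inner set \<Rightarrow> 'a \<Rightarrow> 'a"
  where "orth_proj L x = (THE y. y \<in> L \<and> x - y \<in> orth_complement L)"

text \<open>
  \<^const>\<open>complex_vector.dim\<close> is 0 on infinite-dimensional subspaces. Here all infinite dimensions are
  identified with \<open>\<infinity>\<close>; finite algebraic and finite Hilbert dimension coincide.
\<close>

definition cdim :: "'a :: complex_inner set \<Rightarrow> enat"
  where "cdim V =
    (if \<exists>B. finite B \<and> V \<subseteq> complex_vector.span B then enat (complex_vector.dim V) else \<infinity>)"

text \<open>
  An unbounded operator is given by its domain \<open>D\<close> and a function \<open>S\<close>. Only the values
  of \<open>S\<close> on \<open>D\<close> enter the definitions.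
\<close>

definition linear_operator :: "'a :: complex_inner set \<Rightarrow> ('a \<Rightarrow> 'a) \<Rightarrow> bool"
  where "linear_operator D S \<longleftrightarrow>
    complex_vector.subspace D \<and>
    (\<forall>f\<in>D. \<forall>g\<in>D. S (f + g) = S f + S g) \<and>
    (\<forall>a. \<forall>f\<in>D. S (a *\<^sub>C f) = a *\<^sub>C S f)"

definition closed_operator :: "'a :: complex_inner set \<Rightarrow> ('a \<Rightarrow> 'a) \<Rightarrow> bool"
  where "closed_operator D S \<longleftrightarrow> closed ((\<lambda>f. (f, S f)) ` D)"

definition densely_defined :: "'a :: complex_inner set \<Rightarrow> bool"
  where "densely_defined D \<longleftrightarrow> closure D = UNIV"

definition symmetric_operator :: "'a :: complex_inner set \<Rightarrow> ('a \<Rightarrow> 'a) \<Rightarrow> bool"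
  where "symmetric_operator D S \<longleftrightarrow> (\<forall>f\<in>D. \<forall>g\<in>D. cinner (S f) g = cinner f (S g))"

definition ran_shift :: "'a :: complex_inner set \<Rightarrow> ('a \<Rightarrow> 'a) \<Rightarrow> complex \<Rightarrow> 'a set"
  where "ran_shift D S z = (\<lambda>f. S f - z *\<^sub>C f) ` D"

definition deficiency_subspace :: "'a :: complex_inner set \<Rightarrow> ('a \<Rightarrow> 'a) \<Rightarrow> complex \<Rightarrow> 'a set"
  where "deficiency_subspace D S z = orth_complement (ran_shift D S (cnj z))"

text \<open>
  The dimension of the deficiency subspace is constant on each open half-plane; the points
  \<open>\<i>\<close> and \<open>- \<i>\<close> serve as representatives.
\<close>

definition n_plus :: "'a :: complex_inner set \<Rightarrow> ('a \<Rightarrow> 'a) \<Rightarrow> enat"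
  where "n_plus D S = cdim (deficiency_subspace D S \<i>)"

definition n_minus :: "'a :: complex_inner set \<Rightarrow> ('a \<Rightarrow> 'a) \<Rightarrow> enat"
  where "n_minus D S = cdim (deficiency_subspace D S (- \<i>))"

definition dom_adjoint :: "'a :: complex_inner set \<Rightarrow> ('a \<Rightarrow> 'a) \<Rightarrow> 'a set"
  where "dom_adjoint D S = {g. \<exists>h. \<forall>f\<in>D. cinner (S f) g = cinner f h}"

definition dom_square :: "'a :: complex_inner set \<Rightarrow> ('a \<Rightarrow> 'a) \<Rightarrow> 'a set"
  where "dom_square D S = {f \<in> D. S f \<in> D}"

definition graph_norm :: "('a :: complex_inner \<Rightarrow> 'a) \<Rightarrow> 'a \<Rightarrow> real"
  where "graph_norm S f = sqrt ((norm f)\<^sup>2 + (norm (S f))\<^sup>2)"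

definition is_core :: "'a :: complex_inner set \<Rightarrow> ('a \<Rightarrow> 'a) \<Rightarrow> 'a set \<Rightarrow> bool"
  where "is_core D S C \<longleftrightarrow>
    complex_vector.subspace C \<and> C \<subseteq> D \<and> (\<forall>f\<in>D. \<forall>e>0. \<exists>g\<in>C. graph_norm S (f - g) < e)"

definition dense_in :: "'a :: complex_inner set \<Rightarrow> 'a set \<Rightarrow> bool"
  where "dense_in X M \<longleftrightarrow> X \<subseteq> M \<and> M \<subseteq> closure X"

definition nontrivial :: "'a :: complex_inner set \<Rightarrow> bool"
  where "nontrivial X \<longleftrightarrow> X \<noteq> {0}"

end

theory Submission
  imports Defs
begin

text \<open>
  Fix a non-real \<open>z\<close>, let \<open>T = S - z\<close>, and let \<open>M\<close> be the range of \<open>T\<close>. Everything about \<open>dom S\<^sup>2\<close> is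
  transported to \<open>M\<close> by \<open>T\<close>. Since \<open>S f\<close> and \<open>T f\<close> differ by a multiple of \<open>f\<close>, \<open>T\<close> maps \<open>dom S\<^sup>2\<close>
  bijectively onto \<open>M \<inter> D\<close>. Symmetry gives \<open>\<bar>Im z\<bar> * \<parallel>f\<parallel> \<le> \<parallel>T f\<parallel>\<close>, so \<open>T\<close> is a homeomorphism from
  \<open>D\<close> with the graph norm onto \<open>M\<close>. Three consequences and one duality argument give the theorem:

  \<^item> \<open>M\<close> is closed, because the graph of \<open>S\<close> is (\<open>closed_M\<close>).
  \<^item> \<open>dom S\<^sup>2\<close> is non-trivial iff \<open>M \<inter> D\<close> is (\<open>nontrivial_D2_iff\<close>).
  \<^item> \<open>dom S\<^sup>2\<close> is a core of \<open>S\<close> iff \<open>M \<inter> D\<close> is dense in \<open>M\<close> (\<open>is_core_D2_iff\<close>).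
  \<^item> Let \<open>R\<close> be the inverse of \<open>T\<close>, a bounded map from \<open>M\<close> to the whole space. Then \<open>dom S\<^sup>2\<close> is the
    image of \<open>M \<inter> D\<close> under \<open>R\<close>, so \<open>y\<close> is orthogonal to \<open>dom S\<^sup>2\<close> iff \<open>R\<^sup>* y\<close> lies in the
    complement of \<open>M \<inter> D\<close> in \<open>M\<close>. The range of \<open>R\<^sup>*\<close> is the projection of \<open>dom S\<^sup>*\<close> onto \<open>M\<close>, and
    \<open>R\<^sup>*\<close> is injective because \<open>D\<close> is dense. Hence \<open>dom S\<^sup>2\<close> is dense iff that projection meets that
    complement only in \<open>0\<close> (\<open>dense_D2_iff\<close>).

  The left-hand sides do not involve \<open>z\<close>, so each condition on \<open>z\<close> holds for all non-real \<open>z\<close> once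
  it holds for one. The existence of \<open>R\<^sup>* y\<close> and of projections rests on the Riesz representation
  theorem, which is proved below for complete real inner product spaces and transferred to complex subspaces.
\<close>

section \<open>Complex and real inner products\<close>

lemma cinner_add_right: "cinner x (y + z) = cinner x y + cinner (x :: 'a :: complex_inner) z"
  by (subst (1 2 3) cinner_commute) (simp add: cinner_add_left)

lemma cinner_scaleC_right: "cinner x (a *\<^sub>C y) = cnj a * cinner (x :: 'a :: complex_inner) y"
  by (subst (1 2) cinner_commute) (simp add: cinner_scaleC_left)

lemma scaleC_minus_one: "(-1) *\<^sub>C x = - (x :: 'a :: complex_inner)"
  using scaleC_complex_of_real[of "-1" x] by simp

lemma cinner_minus_left: "cinner (- x) y = - cinner (x :: 'a :: complex_inner) y"
  using cinner_scaleC_left[of "-1" x y] by (simp add: scaleC_minus_one)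

lemma cinner_minus_right: "cinner x (- y) = - cinner (x :: 'a :: complex_inner) y"
  using cinner_scaleC_right[of x "-1" y] by (simp add: scaleC_minus_one)

lemma cinner_diff_left: "cinner (x - y) z = cinner x z - cinner (y :: 'a :: complex_inner) z"
  using cinner_add_left[of x "- y" z] by (simp add: cinner_minus_left)

lemma cinner_diff_right: "cinner x (y - z) = cinner x y - cinner (x :: 'a :: complex_inner) z"
  using cinner_add_right[of x y "- z"] by (simp add: cinner_minus_right)

lemma cinner_zero_right: "cinner x 0 = (0 :: complex)" for x :: "'a :: complex_inner"
  using cinner_diff_right[of x 0 0] by simp

lemma Im_cinner: "Im (cinner x y) = inner ((- \<i>) *\<^sub>C x) (y :: 'a :: complex_inner)"
  unfolding Re_cinner[symmetric] cinner_scaleC_left by simp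

lemma norm_scaleC: "norm (a *\<^sub>C x) = cmod a * norm (x :: 'a :: complex_inner)"
proof -
  have "complex_of_real ((norm (a *\<^sub>C x))\<^sup>2) = a * cnj a * complex_of_real ((norm x)\<^sup>2)"
    by (simp only: cinner_self[symmetric] cinner_scaleC_left cinner_scaleC_right mult_ac)
  also have "\<dots> = complex_of_real ((cmod a * norm x)\<^sup>2)"
    by (simp add: complex_norm_square power_mult_distrib del: of_real_power)
  finally have "(norm (a *\<^sub>C x))\<^sup>2 = (cmod a * norm x)\<^sup>2"
    by (simp only: of_real_eq_iff)
  then show ?thesis
    by (simp add: power2_eq_iff_nonneg)
qed

lemma abs_Im_cinner_le: "\<bar>Im (cinner x y)\<bar> \<le> norm x * norm (y :: 'a :: complex_inner)"
  using Cauchy_Schwarz_ineq2[of "(- \<i>) *\<^sub>C x" y] by (simp only: Im_cinner norm_scaleC) simp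

lemma bounded_linear_scaleC: "bounded_linear (\<lambda>x :: 'a :: complex_inner. a *\<^sub>C x)"
proof (rule bounded_linear_intro[where K = "cmod a"])
  show "a *\<^sub>C (r *\<^sub>R x) = r *\<^sub>R (a *\<^sub>C x)" for r and x :: 'a
    by (simp only: scaleC_complex_of_real[symmetric] scaleC_scaleC mult.commute)
qed (simp_all add: scaleC_add_right norm_scaleC mult.commute)

lemma subspace_of_complex_subspace:
  assumes "complex_vector.subspace V"
  shows "subspace V"
proof (rule subspaceI)
  show "r *\<^sub>R x \<in> V" if "x \<in> V" for r x
    using complex_vector.subspace_scale[OF assms that, of "complex_of_real r"]
    by (simp only: scaleC_complex_of_real)
qed (use assms complex_vector.subspace_0 complex_vector.subspace_add in blast)+

text \<open>
  The imaginary part of \<open>cinner x y\<close> is the real inner product of \<open>- \<i> *\<^sub>C x\<close> and \<open>y\<close>, so on a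
  complex subspace real orthogonality already gives complex orthogonality. Questions of density
  and projection are thereby questions about real inner product spaces.
\<close>

lemma mem_orth_complement_subspace_iff:
  assumes "complex_vector.subspace V"
  shows "y \<in> orth_complement V \<longleftrightarrow> (\<forall>x\<in>V. inner x y = 0)"
proof
  assume "y \<in> orth_complement V"
  then show "\<forall>x\<in>V. inner x y = 0"
    by (auto simp: orth_complement_def Re_cinner[symmetric])
next
  assume "\<forall>x\<in>V. inner x y = 0"
  then show "y \<in> orth_complement V"
    using complex_vector.subspace_scale[OF assms]
    by (auto simp: orth_complement_def complex_eq_iff Im_cinner Re_cinner)
qed

section \<open>Riesz representation and orthogonal projection\<close>

text \<open>
  The representing vector minimises \<open>\<parallel>m\<parallel>\<^sup>2 - 2 \<phi> m\<close> over \<open>M\<close>. By the parallelogram law a minimising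
  sequence is Cauchy, and the first-order condition at its limit is the representation.
\<close>

lemma riesz_on_closed_subspace:
  fixes M :: "'a :: {real_inner, complete_space} set" and \<phi> :: "'a \<Rightarrow> real"
  assumes sub: "subspace M" and "closed M"
    and add: "\<And>x y. x \<in> M \<Longrightarrow> y \<in> M \<Longrightarrow> \<phi> (x + y) = \<phi> x + \<phi> y"
    and scale: "\<And>r x. x \<in> M \<Longrightarrow> \<phi> (r *\<^sub>R x) = r * \<phi> x"
    and bound: "\<And>x. x \<in> M \<Longrightarrow> \<bar>\<phi> x\<bar> \<le> K * norm x"
  obtains g where "g \<in> M" "\<And>m. m \<in> M \<Longrightarrow> inner m g = \<phi> m"
proof -
  define J where "J m = (norm m)\<^sup>2 - 2 * \<phi> m" for m
  have J_lower: "- K\<^sup>2 \<le> J m" if "m \<in> M" for m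
  proof -
    have "0 \<le> (norm m - K)\<^sup>2" by simp
    then show ?thesis
      using bound[OF that] by (simp add: J_def power2_eq_square algebra_simps)
  qed
  have "0 \<in> M" using sub by (rule subspace_0)
  define d where "d = Inf (J ` M)"
  have bdd: "bdd_below (J ` M)"
    using J_lower by (rule bdd_belowI2)
  have d_le: "d \<le> J m" if "m \<in> M" for m
    unfolding d_def using bdd that by (simp add: cINF_lower)
  have near: "\<exists>m\<in>M. J m < d + e" if "e > 0" for e
    using cINF_less_iff[of M J "d + e"] bdd \<open>0 \<in> M\<close> that unfolding d_def by auto
  obtain m where mM: "\<And>n. m n \<in> M" and mJ: "\<And>n. J (m n) < d + inverse (real (Suc n))"
    using near[of "inverse (real (Suc n))" for n] by (metis inverse_positive_iff_positive of_nat_0_less_iff zero_less_Suc)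
  have gap: "(norm (m n - m k))\<^sup>2 \<le> 2 * inverse (real (Suc n)) + 2 * inverse (real (Suc k))" for n k
  proof -
    let ?c = "(1/2) *\<^sub>R (m n + m k)"
    have "?c \<in> M"
      using mM sub by (simp add: subspace_add subspace_scale)
    have "\<phi> ?c = (\<phi> (m n) + \<phi> (m k)) / 2"
      using mM sub by (subst scale) (simp_all add: add subspace_add)
    moreover have "(norm ?c)\<^sup>2 = (norm (m n + m k))\<^sup>2 / 4"
      by (simp add: power_divide)
    ultimately have "(norm (m n - m k))\<^sup>2 = 2 * J (m n) + 2 * J (m k) - 4 * J ?c"
      by (simp add: J_def power2_norm_eq_inner inner_commute algebra_simps)
    then show ?thesis
      using d_le[OF \<open>?c \<in> M\<close>] mJ[of n] mJ[of k] by linarith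
  qed
  have "Cauchy m"
  proof (rule metric_CauchyI)
    fix e :: real assume "e > 0"
    then have "e\<^sup>2 / 4 > 0" by simp
    then obtain N where N: "inverse (real (Suc N)) < e\<^sup>2 / 4"
      using reals_Archimedean by blast
    have "dist (m n) (m k) < e" if "n \<ge> N" "k \<ge> N" for n k
    proof -
      have "inverse (real (Suc n)) \<le> inverse (real (Suc N))"
        "inverse (real (Suc k)) \<le> inverse (real (Suc N))"
        using that by (simp_all add: le_imp_inverse_le)
      then have "(norm (m n - m k))\<^sup>2 < e\<^sup>2"
        using gap[of n k] N by linarith
      then show ?thesis
        using \<open>e > 0\<close> by (simp add: dist_norm power2_less_imp_less)
    qed
    then show "\<exists>N. \<forall>n\<ge>N. \<forall>k\<ge>N. dist (m n) (m k) < e" by blast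
  qed
  then obtain g where lim: "m \<longlonglongrightarrow> g"
    using Cauchy_convergent convergent_def by blast
  have "g \<in> M"
    using \<open>closed M\<close> mM lim by (metis closed_sequentially)
  have "(\<lambda>n. \<phi> (m n)) \<longlonglongrightarrow> \<phi> g"
  proof (rule LIM_zero_cancel, rule Lim_null_comparison)
    show "\<forall>\<^sub>F n in sequentially. norm (\<phi> (m n) - \<phi> g) \<le> K * norm (m n - g)"
    proof (intro always_eventually allI)
      fix n
      have "m n - g \<in> M" using sub mM \<open>g \<in> M\<close> by (simp add: subspace_diff)
      moreover have "\<phi> (m n) = \<phi> (m n - g) + \<phi> g"
        using add[OF \<open>m n - g \<in> M\<close> \<open>g \<in> M\<close>] by simp
      ultimately show "norm (\<phi> (m n) - \<phi> g) \<le> K * norm (m n - g)"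
        using bound by simp
    qed
    show "(\<lambda>n. K * norm (m n - g)) \<longlonglongrightarrow> 0"
      using lim by (intro tendsto_mult_right_zero tendsto_norm_zero) (simp add: LIM_zero)
  qed
  then have "(\<lambda>n. J (m n)) \<longlonglongrightarrow> J g"
    unfolding J_def by (intro tendsto_intros lim)
  moreover have "(\<lambda>n. d + inverse (real (Suc n))) \<longlonglongrightarrow> d"
    using tendsto_add[OF tendsto_const LIMSEQ_inverse_real_of_nat] by simp
  ultimately have "J g \<le> d"
    by (rule LIMSEQ_le) (use mJ less_imp_le in blast)
  have "inner x g = \<phi> x" if "x \<in> M" for x
  proof (cases "x = 0")
    case True
    then show ?thesis using scale[OF \<open>x \<in> M\<close>, of 0] by simp
  next
    case False
    \<comment> \<open>The step \<open>t\<close> minimises the quadratic \<open>t \<mapsto> J (g + t *\<^sub>R x)\<close>.\<close>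
    define b where "b = inner x g - \<phi> x"
    define t where "t = - b / (norm x)\<^sup>2"
    have "g + t *\<^sub>R x \<in> M"
      using sub \<open>g \<in> M\<close> \<open>x \<in> M\<close> by (simp add: subspace_add subspace_scale)
    moreover have "J (g + t *\<^sub>R x) = J g + 2 * t * b + t\<^sup>2 * (norm x)\<^sup>2"
      using add[OF \<open>g \<in> M\<close>, of "t *\<^sub>R x"] scale[OF \<open>x \<in> M\<close>, of t] sub \<open>x \<in> M\<close>
      by (simp add: J_def b_def power2_norm_eq_inner subspace_scale inner_commute
          power2_eq_square[of t] algebra_simps)
    moreover have "2 * t * b + t\<^sup>2 * (norm x)\<^sup>2 = - (b\<^sup>2 / (norm x)\<^sup>2)"
      using False by (simp add: t_def power2_eq_square field_simps)
    ultimately have "b\<^sup>2 / (norm x)\<^sup>2 \<le> 0"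
      using d_le[of "g + t *\<^sub>R x"] \<open>J g \<le> d\<close> by linarith
    then have "b = 0"
      using False by (simp add: divide_le_0_iff)
    then show ?thesis by (simp add: b_def)
  qed
  with \<open>g \<in> M\<close> show thesis using that by blast
qed

lemma closed_subspace_decomposition:
  fixes M :: "'a :: {real_inner, complete_space} set"
  assumes "subspace M" "closed M"
  obtains p where "p \<in> M" "\<And>m. m \<in> M \<Longrightarrow> inner m (x - p) = 0"
proof (rule riesz_on_closed_subspace[OF assms, of "\<lambda>m. inner m x" "norm x"])
  show "\<bar>inner m x\<bar> \<le> norm x * norm m" for m
    using Cauchy_Schwarz_ineq2[of m x] by (simp add: mult.commute)
next
  fix p assume "p \<in> M" "\<And>m. m \<in> M \<Longrightarrow> inner m p = inner m x"
  then show thesis using that by (simp add: inner_diff_right)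
qed (simp_all add: inner_add_left)

lemma subspace_closure:
  fixes V :: "'a :: real_normed_vector set"
  assumes "subspace V"
  shows "subspace (closure V)"
proof (rule subspaceI)
  show "0 \<in> closure V"
    using subspace_0[OF assms] closure_subset by blast
next
  fix x y assume "x \<in> closure V" "y \<in> closure V"
  then obtain u v where "\<And>n. u n \<in> V" "u \<longlonglongrightarrow> x" "\<And>n. v n \<in> V" "v \<longlonglongrightarrow> y"
    unfolding closure_sequential by blast
  then have "\<And>n. u n + v n \<in> V" "(\<lambda>n. u n + v n) \<longlonglongrightarrow> x + y"
    using assms by (auto intro: subspace_add tendsto_add)
  then show "x + y \<in> closure V"
    unfolding closure_sequential by (intro exI[of _ "\<lambda>n. u n + v n"]) blast
next
  fix r x assume "x \<in> closure V"
  then obtain u where "\<And>n. u n \<in> V" "u \<longlonglongrightarrow> x"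
    unfolding closure_sequential by blast
  then have "\<And>n. r *\<^sub>R u n \<in> V" "(\<lambda>n. r *\<^sub>R u n) \<longlonglongrightarrow> r *\<^sub>R x"
    using assms by (auto intro: subspace_scale tendsto_scaleR)
  then show "r *\<^sub>R x \<in> closure V"
    unfolding closure_sequential by (intro exI[of _ "\<lambda>n. r *\<^sub>R u n"]) blast
qed

lemma orthogonal_closure:
  fixes y :: "'a :: real_inner"
  assumes "\<forall>x\<in>V. inner x y = 0" and "x \<in> closure V"
  shows "inner x y = 0"
proof -
  have "closed {x. inner x y = 0}"
    by (intro closed_Collect_eq continuous_intros)
  then have "closure V \<subseteq> {x. inner x y = 0}"
    using assms(1) by (intro closure_minimal) auto
  with assms(2) show ?thesis by auto
qed

lemma dense_in_iff_orthogonal_trivial: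
  fixes V M :: "'a :: complex_hilbert set"
  assumes V: "complex_vector.subspace V" and M: "complex_vector.subspace M" and "closed M" "V \<subseteq> M"
  shows "dense_in V M \<longleftrightarrow> M \<inter> orth_complement V = {0}"
proof
  assume dense: "dense_in V M"
  have "y = 0" if "y \<in> M" "y \<in> orth_complement V" for y
  proof -
    have "inner y y = 0"
      using that dense orthogonal_closure[of V y y]
      by (auto simp: dense_in_def mem_orth_complement_subspace_iff[OF V])
    then show ?thesis by simp
  qed
  then show "M \<inter> orth_complement V = {0}"
    using complex_vector.subspace_0[OF M] by (auto simp: orth_complement_def cinner_zero_right)
next
  assume triv: "M \<inter> orth_complement V = {0}"
  have "x \<in> closure V" if "x \<in> M" for x
  proof -
    obtain p where p: "p \<in> closure V" "\<And>v. v \<in> closure V \<Longrightarrow> inner v (x - p) = 0"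
      using closed_subspace_decomposition[of "closure V" x]
        subspace_closure[OF subspace_of_complex_subspace[OF V]] by auto
    have "p \<in> M"
      using p(1) \<open>V \<subseteq> M\<close> \<open>closed M\<close> closure_minimal by blast
    then have "x - p \<in> M"
      using complex_vector.subspace_diff[OF M that] by blast
    moreover have "x - p \<in> orth_complement V"
      using p(2) closure_subset by (auto simp: mem_orth_complement_subspace_iff[OF V])
    ultimately have "x - p = 0" using triv by blast
    then show ?thesis using p(1) by simp
  qed
  then show "dense_in V M" using \<open>V \<subseteq> M\<close> by (auto simp: dense_in_def)
qed

lemma orth_proj_eqI:
  assumes L: "complex_vector.subspace L" and y: "y \<in> L" "x - y \<in> orth_complement L"
  shows "orth_proj L x = y"
  unfolding orth_proj_def
proof (rule the_equality)
  fix w assume w: "w \<in> L \<and> x - w \<in> orth_complement L"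
  then have "w - y \<in> L" using L y by (simp add: complex_vector.subspace_diff)
  moreover have "inner (w - y) (w - y) = inner (w - y) (x - y) - inner (w - y) (x - w)"
    by (simp add: inner_diff_right)
  ultimately have "inner (w - y) (w - y) = 0"
    using w y by (simp add: mem_orth_complement_subspace_iff[OF L])
  then show "w = y" by simp
qed (use y in blast)

lemma orth_proj_closed_subspace:
  fixes L :: "'a :: complex_hilbert set"
  assumes L: "complex_vector.subspace L" and "closed L"
  shows "orth_proj L x \<in> L" "x - orth_proj L x \<in> orth_complement L"
proof -
  obtain p where "p \<in> L" "\<And>m. m \<in> L \<Longrightarrow> inner m (x - p) = 0"
    using closed_subspace_decomposition[OF subspace_of_complex_subspace[OF L] \<open>closed L\<close>] by blast
  then have "p \<in> L" "x - p \<in> orth_complement L"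
    by (auto simp: mem_orth_complement_subspace_iff[OF L])
  then show "orth_proj L x \<in> L" "x - orth_proj L x \<in> orth_complement L"
    using orth_proj_eqI[OF L] by metis+
qed

section \<open>The operator \<open>S - z\<close> for non-real \<open>z\<close>\<close>

locale symmetric_shift =
  fixes D :: "'a :: complex_hilbert set" and S :: "'a \<Rightarrow> 'a" and z :: complex
  assumes linear: "linear_operator D S" and sym: "symmetric_operator D S"
    and non_real: "z \<notin> \<real>"
begin

abbreviation T :: "'a \<Rightarrow> 'a" where "T f \<equiv> S f - z *\<^sub>C f"

abbreviation M :: "'a set" where "M \<equiv> ran_shift D S z"

abbreviation D2 :: "'a set" where "D2 \<equiv> dom_square D S"

lemma subspace_D: "complex_vector.subspace D"
  using linear by (simp add: linear_operator_def)

lemma S_add: "f \<in> D \<Longrightarrow> g \<in> D \<Longrightarrow> S (f + g) = S f + S g"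
  using linear by (simp add: linear_operator_def)

lemma S_scaleC: "f \<in> D \<Longrightarrow> S (a *\<^sub>C f) = a *\<^sub>C S f"
  using linear by (simp add: linear_operator_def)

lemma S_zero: "S 0 = 0"
  using S_scaleC[of 0 0] complex_vector.subspace_0[OF subspace_D] by simp

lemma T_add: "f \<in> D \<Longrightarrow> g \<in> D \<Longrightarrow> T (f + g) = T f + T g"
  by (simp add: S_add scaleC_add_right)

lemma T_scaleC: "f \<in> D \<Longrightarrow> T (a *\<^sub>C f) = a *\<^sub>C T f"
  by (simp add: S_scaleC complex_vector.scale_right_diff_distrib mult.commute)

lemma T_diff:
  assumes "f \<in> D" "g \<in> D"
  shows "T (f - g) = T f - T g"
proof -
  have "T f = T (f - g) + T g"
    using T_add[OF complex_vector.subspace_diff[OF subspace_D assms] assms(2)]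
    by (simp only: diff_add_cancel)
  then show ?thesis by (simp only: eq_diff_eq)
qed

lemma subspace_M: "complex_vector.subspace M"
proof (rule complex_vector.subspaceI)
  show "0 \<in> M"
    using complex_vector.subspace_0[OF subspace_D] by (force simp: ran_shift_def S_zero)
next
  fix x y assume "x \<in> M" "y \<in> M"
  then obtain f g where "f \<in> D" "g \<in> D" "x = T f" "y = T g" by (auto simp: ran_shift_def)
  then show "x + y \<in> M"
    using T_add[of f g] complex_vector.subspace_add[OF subspace_D, of f g]
    unfolding ran_shift_def by (intro image_eqI[where x = "f + g"]) simp_all
next
  fix a x assume "x \<in> M"
  then obtain f where "f \<in> D" "x = T f" by (auto simp: ran_shift_def)
  then show "a *\<^sub>C x \<in> M"
    using T_scaleC[of f a] complex_vector.subspace_scale[OF subspace_D, of f a]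
    unfolding ran_shift_def by (intro image_eqI[where x = "a *\<^sub>C f"]) simp_all
qed

lemma subspace_MD: "complex_vector.subspace (M \<inter> D)"
  by (rule complex_vector.subspace_inter[OF subspace_M subspace_D])

lemma subspace_D2: "complex_vector.subspace D2"
proof (rule complex_vector.subspaceI)
  show "0 \<in> D2"
    using complex_vector.subspace_0[OF subspace_D] by (simp add: dom_square_def S_zero)
  show "f + g \<in> D2" if "f \<in> D2" "g \<in> D2" for f g
    using that complex_vector.subspace_add[OF subspace_D] by (simp add: dom_square_def S_add)
  show "a *\<^sub>C f \<in> D2" if "f \<in> D2" for a f
    using that complex_vector.subspace_scale[OF subspace_D] by (simp add: dom_square_def S_scaleC)
qed

text \<open>
  For \<open>f \<in> D\<close> the vectors \<open>S f\<close> and \<open>T f\<close> differ by an element of \<open>D\<close>.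
\<close>

lemma T_image_D2: "T ` D2 = M \<inter> D"
proof -
  have "S f \<in> D \<longleftrightarrow> T f \<in> D" if "f \<in> D" for f
  proof -
    have zf: "z *\<^sub>C f \<in> D" using that subspace_D by (simp add: complex_vector.subspace_scale)
    then show ?thesis
      using complex_vector.subspace_add[OF subspace_D, of "T f" "z *\<^sub>C f"]
        complex_vector.subspace_diff[OF subspace_D, of "S f" "z *\<^sub>C f"] by auto
  qed
  then show ?thesis by (auto simp: ran_shift_def dom_square_def)
qed

text \<open>
  Since \<open>cinner (S f) f\<close> is real, the imaginary part of \<open>cinner (T f) f\<close> is \<open>- Im z * \<parallel>f\<parallel>\<^sup>2\<close>. This one
  inequality makes \<open>T\<close> injective with bounded inverse.
\<close>

lemma norm_T_ge:
  assumes "f \<in> D"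
  shows "\<bar>Im z\<bar> * norm f \<le> norm (T f)"
proof (cases "f = 0")
  case False
  have "cnj (cinner (S f) f) = cinner (S f) f"
    using sym assms cinner_commute[of f "S f"] by (auto simp: symmetric_operator_def)
  then have "Im (cinner (S f) f) = 0"
    by (simp add: complex_eq_iff)
  then have "Im (cinner (T f) f) = - Im z * (norm f)\<^sup>2"
    by (simp add: cinner_diff_left cinner_scaleC_left cinner_self del: of_real_power)
  then have "\<bar>Im z\<bar> * (norm f)\<^sup>2 \<le> norm (T f) * norm f"
    using abs_Im_cinner_le[of "T f" f] by (simp add: abs_mult)
  then show ?thesis
    using False by (simp add: power2_eq_square mult.assoc[symmetric])
qed simp

lemma Im_z_pos: "0 < \<bar>Im z\<bar>"
  using non_real by (simp add: complex_is_Real_iff)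

lemma T_inj_on: "inj_on T D"
proof (rule inj_onI)
  fix f g assume "f \<in> D" "g \<in> D" "T f = T g"
  then have "norm (T (f - g)) = 0" by (simp only: T_diff) simp
  moreover have "f - g \<in> D"
    using \<open>f \<in> D\<close> \<open>g \<in> D\<close> subspace_D by (simp add: complex_vector.subspace_diff)
  ultimately have "\<bar>Im z\<bar> * norm (f - g) \<le> 0" using norm_T_ge by metis
  then show "f = g" using Im_z_pos by (simp add: mult_le_0_iff)
qed

lemma nontrivial_D2_iff: "nontrivial D2 \<longleftrightarrow> nontrivial (M \<inter> D)"
proof -
  have "0 \<in> D" by (rule complex_vector.subspace_0[OF subspace_D])
  have "T f = 0 \<longleftrightarrow> f = 0" if "f \<in> D2" for f
  proof -
    have "T f = T 0 \<longleftrightarrow> f = 0"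
      using T_inj_on that \<open>0 \<in> D\<close> by (intro inj_on_eq_iff) (auto simp: dom_square_def)
    then show ?thesis by (simp add: S_zero)
  qed
  then have "T ` D2 \<subseteq> {0} \<longleftrightarrow> D2 \<subseteq> {0}"
    by (auto simp: image_subset_iff)
  then show ?thesis
    using complex_vector.subspace_0[OF subspace_D2] complex_vector.subspace_0[OF subspace_MD]
    unfolding nontrivial_def T_image_D2 by blast
qed

text \<open>Hence the graph norm is equivalent to \<open>f \<mapsto> \<parallel>T f\<parallel>\<close> on \<open>D\<close>.\<close>

lemma norm_T_le_graph_norm: "norm (T f) \<le> (1 + cmod z) * graph_norm S f"
proof -
  have "norm (T f) \<le> norm (S f) + cmod z * norm f"
    using norm_triangle_ineq4[of "S f" "z *\<^sub>C f"] by (simp add: norm_scaleC)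
  also have "\<dots> \<le> graph_norm S f + cmod z * graph_norm S f"
    by (intro add_mono mult_left_mono) (simp_all add: graph_norm_def real_le_rsqrt)
  finally show ?thesis by (simp add: algebra_simps)
qed

lemma graph_norm_le_norm_T:
  assumes "f \<in> D"
  shows "graph_norm S f \<le> ((1 + cmod z) / \<bar>Im z\<bar> + 1) * norm (T f)"
proof -
  have f: "norm f \<le> norm (T f) / \<bar>Im z\<bar>"
    using norm_T_ge[OF assms] Im_z_pos by (simp add: field_simps)
  have "graph_norm S f \<le> norm f + norm (S f)"
    unfolding graph_norm_def by (rule sqrt_sum_squares_le_sum) simp_all
  also have "norm (S f) \<le> norm (T f) + cmod z * norm f"
    using norm_triangle_ineq[of "T f" "z *\<^sub>C f"] by (simp add: norm_scaleC)
  finally have "graph_norm S f \<le> (1 + cmod z) * norm f + norm (T f)"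
    by (simp add: algebra_simps)
  also have "(1 + cmod z) * norm f \<le> (1 + cmod z) * (norm (T f) / \<bar>Im z\<bar>)"
    using f by (rule mult_left_mono) simp
  finally show ?thesis by (simp add: algebra_simps)
qed

text \<open>
  The map \<open>(f, S f) \<mapsto> T f\<close> is bounded, and bounded below, on the graph. A closed graph is
  complete, and therefore so is its image \<open>M\<close>.
\<close>

lemma closed_M:
  assumes "closed_operator D S"
  shows "closed M"
proof -
  define G where "G = (\<lambda>f. (f, S f)) ` D"
  define F where "F = (\<lambda>p :: 'a \<times> 'a. snd p - z *\<^sub>C fst p)"
  define c where "c = (1 + cmod z) / \<bar>Im z\<bar> + 1"
  have "c > 0" using Im_z_pos by (simp add: c_def add_nonneg_pos)
  have "subspace G"
  proof (rule subspaceI)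
    show "0 \<in> G"
      using complex_vector.subspace_0[OF subspace_D] by (force simp: G_def S_zero zero_prod_def)
  next
    fix x y assume "x \<in> G" "y \<in> G"
    then show "x + y \<in> G"
      using complex_vector.subspace_add[OF subspace_D] by (force simp: G_def S_add)
  next
    fix r x assume "x \<in> G"
    then show "r *\<^sub>R x \<in> G"
      using complex_vector.subspace_scale[OF subspace_D, of _ "complex_of_real r"]
        S_scaleC[of _ "complex_of_real r"]
      by (force simp: G_def scaleC_complex_of_real)
  qed
  moreover have "bounded_linear F"
    unfolding F_def
    by (intro bounded_linear_sub bounded_linear_snd
        bounded_linear_compose[OF bounded_linear_scaleC bounded_linear_fst])
  moreover have "\<forall>x\<in>G. norm (F x) \<ge> inverse c * norm x"
  proof
    fix x assume "x \<in> G"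
    then obtain f where f: "f \<in> D" "x = (f, S f)" by (auto simp: G_def)
    have "norm x \<le> c * norm (F x)"
      using graph_norm_le_norm_T[OF f(1)] f(2)
      by (simp add: c_def F_def graph_norm_def norm_Pair)
    then show "norm (F x) \<ge> inverse c * norm x"
      using \<open>c > 0\<close> by (simp add: field_simps)
  qed
  moreover have "complete G"
    using assms by (simp add: closed_operator_def G_def complete_eq_closed)
  ultimately have "complete (F ` G)"
    using \<open>c > 0\<close> by (intro complete_isometric_image[of "inverse c"]) simp_all
  moreover have "F ` G = M"
    by (auto simp: F_def G_def ran_shift_def image_image)
  ultimately show ?thesis
    by (simp add: complete_eq_closed)
qed

lemma is_core_D2_iff: "is_core D S D2 \<longleftrightarrow> dense_in (M \<inter> D) M"
proof
  assume core: "is_core D S D2"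
  show "dense_in (M \<inter> D) M"
    unfolding dense_in_def
  proof (intro conjI subsetI)
    fix x assume "x \<in> M"
    then obtain f where f: "f \<in> D" "x = T f" by (auto simp: ran_shift_def)
    show "x \<in> closure (M \<inter> D)"
      unfolding closure_approachable
    proof (intro allI impI)
      fix e :: real assume "e > 0"
      have pos: "1 + cmod z > 0" by (simp add: add_pos_nonneg)
      with \<open>e > 0\<close> have "e / (1 + cmod z) > 0" by simp
      then obtain g where g: "g \<in> D2" "graph_norm S (f - g) < e / (1 + cmod z)"
        using core f(1) unfolding is_core_def by blast
      then have "g \<in> D" by (simp add: dom_square_def)
      have "norm (T f - T g) \<le> (1 + cmod z) * graph_norm S (f - g)"
        using norm_T_le_graph_norm[of "f - g"] T_diff[OF f(1) \<open>g \<in> D\<close>] by simp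
      also have "\<dots> < e"
        using g(2) pos by (simp add: field_simps)
      finally have "dist (T g) x < e" by (simp add: dist_norm norm_minus_commute f(2))
      then show "\<exists>y\<in>M \<inter> D. dist y x < e"
        using g(1) T_image_D2 by blast
    qed
  qed simp
next
  assume dense: "dense_in (M \<inter> D) M"
  define c where "c = (1 + cmod z) / \<bar>Im z\<bar> + 1"
  have "c > 0" using Im_z_pos by (simp add: c_def add_nonneg_pos)
  have "\<exists>g\<in>D2. graph_norm S (f - g) < e" if "f \<in> D" "e > 0" for f e
  proof -
    have "T f \<in> closure (M \<inter> D)"
      using dense \<open>f \<in> D\<close> by (auto simp: dense_in_def ran_shift_def)
    moreover have "e / c > 0" using \<open>e > 0\<close> \<open>c > 0\<close> by simp
    ultimately obtain y where "y \<in> M \<inter> D" "dist y (T f) < e / c"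
      unfolding closure_approachable by blast
    then obtain g where g: "g \<in> D2" "dist (T g) (T f) < e / c"
      unfolding T_image_D2[symmetric] by blast
    then have "g \<in> D" by (simp add: dom_square_def)
    then have "f - g \<in> D" using \<open>f \<in> D\<close> subspace_D by (simp add: complex_vector.subspace_diff)
    then have "graph_norm S (f - g) \<le> c * norm (T f - T g)"
      using graph_norm_le_norm_T[of "f - g"] T_diff[OF \<open>f \<in> D\<close> \<open>g \<in> D\<close>] by (simp add: c_def)
    also have "\<dots> < e"
      using g(2) \<open>c > 0\<close> by (simp add: dist_norm norm_minus_commute field_simps)
    finally show ?thesis using g(1) by blast
  qed
  then show "is_core D S D2"
    using subspace_D2 by (auto simp: is_core_def dom_square_def)
qed

section \<open>The adjoint and the density of \<open>dom S\<^sup>2\<close>\<close>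

text \<open>
  The vector \<open>g\<close> is the adjoint of the bounded inverse of \<open>T\<close>, applied to \<open>y\<close>; it represents the
  functional \<open>T f \<mapsto> inner f y\<close> on \<open>M\<close>. In terms of the adjoint operator, \<open>S\<^sup>* - cnj z\<close> maps
  \<open>M \<inter> dom S\<^sup>*\<close> onto the whole space.
\<close>

lemma adjoint_shift_surjective:
  assumes "closed_operator D S"
  obtains g where "g \<in> M" "\<And>f. f \<in> D \<Longrightarrow> cinner (T f) g = cinner f y"
proof -
  define R where "R = inv_into D T"
  have RT: "R (T f) = f" if "f \<in> D" for f
    using T_inj_on that unfolding R_def by (rule inv_into_f_f)
  obtain g where g: "g \<in> M" "\<And>m. m \<in> M \<Longrightarrow> inner m g = inner (R m) y"
  proof (rule riesz_on_closed_subspace[OF subspace_of_complex_subspace[OF subspace_M]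
        closed_M[OF assms], of "\<lambda>m. inner (R m) y" "norm y / \<bar>Im z\<bar>"])
    fix u v assume "u \<in> M" "v \<in> M"
    then obtain f h where fh: "f \<in> D" "h \<in> D" "u = T f" "v = T h" by (auto simp: ran_shift_def)
    then have "R (u + v) = f + h"
      using RT[of "f + h"] T_add[of f h] complex_vector.subspace_add[OF subspace_D, of f h] by simp
    then show "inner (R (u + v)) y = inner (R u) y + inner (R v) y"
      using fh RT by (simp add: inner_add_left)
  next
    fix r u assume "u \<in> M"
    then obtain f where f: "f \<in> D" "u = T f" by (auto simp: ran_shift_def)
    then have "R (r *\<^sub>R u) = r *\<^sub>R f"
      using RT[of "r *\<^sub>R f"] T_scaleC[of f "complex_of_real r"]
        complex_vector.subspace_scale[OF subspace_D, of f "complex_of_real r"]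
      by (simp add: scaleC_complex_of_real)
    then show "inner (R (r *\<^sub>R u)) y = r * inner (R u) y"
      using f RT by simp
  next
    fix u assume "u \<in> M"
    then obtain f where f: "f \<in> D" "u = T f" by (auto simp: ran_shift_def)
    have "\<bar>inner f y\<bar> \<le> norm f * norm y" by (rule Cauchy_Schwarz_ineq2)
    also have "norm f \<le> norm u / \<bar>Im z\<bar>"
      unfolding f(2) using norm_T_ge[OF f(1)] Im_z_pos by (simp add: field_simps)
    finally have "\<bar>inner f y\<bar> \<le> norm u / \<bar>Im z\<bar> * norm y" by (simp add: mult_right_mono)
    then show "\<bar>inner (R u) y\<bar> \<le> norm y / \<bar>Im z\<bar> * norm u"
      using f RT by (simp add: mult.commute)
  qed (rule that)
  have real_part: "inner (T f) g = inner f y" if "f \<in> D" for f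
    using g(2)[of "T f"] RT[OF that] that by (auto simp: ran_shift_def)
  have "cinner (T f) g = cinner f y" if "f \<in> D" for f
    using real_part[OF that] real_part[of "(- \<i>) *\<^sub>C f"] T_scaleC[OF that, of "- \<i>"]
      complex_vector.subspace_scale[OF subspace_D that, of "- \<i>"]
    by (simp only: complex_eq_iff Re_cinner Im_cinner)
  with g(1) show thesis using that by blast
qed

lemma zero_in_proj_dom_adjoint: "0 \<in> orth_proj M ` dom_adjoint D S"
proof (rule image_eqI)
  show "0 = orth_proj M 0"
    using complex_vector.subspace_0[OF subspace_M]
    by (intro orth_proj_eqI[symmetric] subspace_M) (simp_all add: orth_complement_def cinner_zero_right)
  show "0 \<in> dom_adjoint D S"
    by (auto simp: dom_adjoint_def cinner_zero_right intro!: exI[of _ 0])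
qed

text \<open>
  A vector \<open>y\<close> is orthogonal to \<open>dom S\<^sup>2\<close> exactly when the vector \<open>g \<in> M\<close> with
  \<open>cinner (T f) g = cinner f y\<close> for all \<open>f \<in> D\<close> is orthogonal to \<open>T ` D2 = M \<inter> D\<close>. These \<open>g\<close>
  are the projections onto \<open>M\<close> of the elements of \<open>dom S\<^sup>*\<close>, and by the density of \<open>D\<close> the vectors
  \<open>g\<close> and \<open>y\<close> vanish together.
\<close>

lemma dense_D2_iff:
  assumes closed: "closed_operator D S" and dense: "densely_defined D"
  shows "dense_in D2 UNIV \<longleftrightarrow>
    orth_proj M ` dom_adjoint D S \<inter> (M \<inter> orth_complement (M \<inter> D)) = {0}"
    (is "_ \<longleftrightarrow> ?I = {0}")
proof -
  note proj = orth_proj_closed_subspace[OF subspace_M closed_M[OF closed]]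
  have dense_D2: "dense_in D2 UNIV \<longleftrightarrow> orth_complement D2 = {0}"
    using dense_in_iff_orthogonal_trivial[OF subspace_D2 complex_vector.subspace_UNIV] by simp
  have orth_D: "orth_complement D = {0}"
    using dense_in_iff_orthogonal_trivial[OF subspace_D complex_vector.subspace_UNIV] dense
    by (simp add: dense_in_def densely_defined_def)
  have zero: "0 \<in> ?I"
    using zero_in_proj_dom_adjoint complex_vector.subspace_0[OF subspace_M]
    by (simp add: orth_complement_def cinner_zero_right)
  show ?thesis
  proof
    assume "dense_in D2 UNIV"
    have "p = 0" if p_in: "p \<in> ?I" for p
    proof -
      have pM: "p \<in> M" and p_orth: "p \<in> orth_complement (M \<inter> D)"
        using p_in by simp_all
      obtain u where p: "p = orth_proj M u" and "u \<in> dom_adjoint D S"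
        using p_in by blast
      then obtain h where uh: "\<And>f. f \<in> D \<Longrightarrow> cinner (S f) u = cinner f h"
        unfolding dom_adjoint_def by blast
      define y where "y = h - cnj z *\<^sub>C u"
      have py: "cinner (T f) p = cinner f y" if "f \<in> D" for f
      proof -
        have "cinner (T f) (u - p) = 0"
          using proj(2)[of u] that by (auto simp: p orth_complement_def ran_shift_def)
        then have "cinner (T f) p = cinner (T f) u" by (simp add: cinner_diff_right)
        also have "\<dots> = cinner f y"
          using uh[OF that]
          by (simp add: y_def cinner_diff_left cinner_diff_right cinner_scaleC_left
              cinner_scaleC_right)
        finally show ?thesis .
      qed
      have "y \<in> orth_complement D2"
        unfolding orth_complement_def
      proof safe
        fix f assume "f \<in> D2"
        then have "T f \<in> M \<inter> D" "f \<in> D" using T_image_D2 by (auto simp: dom_square_def)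
        then show "cinner f y = 0"
          using py[of f] p_orth unfolding orth_complement_def by simp
      qed
      then have "y = 0" using \<open>dense_in D2 UNIV\<close> dense_D2 by auto
      then have "p \<in> orth_complement M"
        using py by (auto simp: orth_complement_def ran_shift_def cinner_zero_right)
      then have "inner p p = 0"
        using pM by (simp add: mem_orth_complement_subspace_iff[OF subspace_M])
      then show ?thesis by simp
    qed
    with zero show "?I = {0}" by blast
  next
    assume I: "?I = {0}"
    have "y = 0" if y: "y \<in> orth_complement D2" for y
    proof -
      obtain g where g: "g \<in> M" "\<And>f. f \<in> D \<Longrightarrow> cinner (T f) g = cinner f y"
        using adjoint_shift_surjective[OF closed] by blast
      have "cinner (S f) g = cinner f (y + cnj z *\<^sub>C g)" if "f \<in> D" for f
        using g(2)[OF that]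
        by (simp add: cinner_diff_left cinner_add_right cinner_scaleC_left cinner_scaleC_right
            algebra_simps)
      then have "g \<in> dom_adjoint D S" by (auto simp: dom_adjoint_def)
      moreover have "orth_proj M g = g"
        using g(1) by (intro orth_proj_eqI subspace_M)
          (simp_all add: orth_complement_def cinner_zero_right)
      moreover have "g \<in> orth_complement (M \<inter> D)"
        unfolding T_image_D2[symmetric] using g(2) y
        by (auto simp: orth_complement_def dom_square_def)
      ultimately have "g \<in> ?I" using g(1) by (metis IntI image_eqI)
      then have "g = 0" using I by blast
      then have "y \<in> orth_complement D"
        using g(2) by (simp add: orth_complement_def cinner_zero_right)
      then show ?thesis using orth_D by blast
    qed
    then show "dense_in D2 UNIV"
      unfolding dense_D2 by (auto simp: orth_complement_def cinner_zero_right)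
  qed
qed

end

section \<open>The two equivalences\<close>

theorem theorem10p1:
  fixes D :: "'a :: complex_hilbert set" and S :: "'a \<Rightarrow> 'a"
  assumes "linear_operator D S"
    and "closed_operator D S"
    and "densely_defined D"
    and "symmetric_operator D S"
    and "n_plus D S = \<infinity>" and "n_minus D S = \<infinity>"
  defines "M \<equiv> ran_shift D S"
  defines "C1 \<equiv> \<lambda>z.
      nontrivial (M z \<inter> D) \<and> \<not> dense_in (M z \<inter> D) (M z) \<and>
      orth_proj (M z) ` dom_adjoint D S \<inter> (M z \<inter> orth_complement (M z \<inter> D)) = {0}"
  defines "C2 \<equiv> \<lambda>z.
      nontrivial (M z \<inter> D) \<and> \<not> dense_in (M z \<inter> D) (M z) \<and>
      orth_proj (M z) ` dom_adjoint D S \<inter> (M z \<inter> orth_complement (M z \<inter> D)) \<noteq> {0}"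
  shows "((dense_in (dom_square D S) UNIV \<and> \<not> is_core D S (dom_square D S))
            \<longleftrightarrow> (\<exists>z. z \<notin> \<real> \<and> C1 z))
       \<and> ((\<exists>z. z \<notin> \<real> \<and> C1 z) \<longleftrightarrow> (\<forall>z. z \<notin> \<real> \<longrightarrow> C1 z))
       \<and> ((nontrivial (dom_square D S) \<and> \<not> dense_in (dom_square D S) UNIV)
            \<longleftrightarrow> (\<exists>z. z \<notin> \<real> \<and> C2 z))
       \<and> ((\<exists>z. z \<notin> \<real> \<and> C2 z) \<longleftrightarrow> (\<forall>z. z \<notin> \<real> \<longrightarrow> C2 z))"
proof -
  let ?D2 = "dom_square D S"
  have shift: "symmetric_shift D S z" if "z \<notin> \<real>" for z
    using assms(1,4) that by unfold_locales
  have nontrivial_iff: "nontrivial ?D2 \<longleftrightarrow> nontrivial (M z \<inter> D)" if "z \<notin> \<real>" for z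
    unfolding M_def by (rule symmetric_shift.nontrivial_D2_iff[OF shift[OF that]])
  have core_iff: "is_core D S ?D2 \<longleftrightarrow> dense_in (M z \<inter> D) (M z)" if "z \<notin> \<real>" for z
    unfolding M_def by (rule symmetric_shift.is_core_D2_iff[OF shift[OF that]])
  have dense_iff: "dense_in ?D2 UNIV \<longleftrightarrow>
      orth_proj (M z) ` dom_adjoint D S \<inter> (M z \<inter> orth_complement (M z \<inter> D)) = {0}"
    if "z \<notin> \<real>" for z
    unfolding M_def by (rule symmetric_shift.dense_D2_iff[OF shift[OF that] assms(2,3)])
  have nonreal: "\<i> \<notin> \<real>" by (simp add: complex_is_Real_iff)
  interpret symmetric_shift D S \<i> by (rule shift[OF nonreal])
  \<comment> \<open>If \<open>{0}\<close> is dense, then the whole space is \<open>{0}\<close>, and \<open>{0} = D\<close> is a core.\<close>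
  have nontrivial_if: "nontrivial ?D2" if "dense_in ?D2 UNIV" "\<not> is_core D S ?D2"
  proof (rule ccontr)
    assume "\<not> nontrivial ?D2"
    with that(1) have "x = 0" for x :: 'a
      by (auto simp: nontrivial_def dense_in_def)
    then have "D = {0}"
      using complex_vector.subspace_0[OF subspace_D] by auto
    then have "M \<i> \<subseteq> M \<i> \<inter> D"
      using \<open>\<And>x :: 'a. x = 0\<close> by auto
    then have "dense_in (M \<i> \<inter> D) (M \<i>)"
      using closure_subset by (fastforce simp: dense_in_def)
    with that(2) core_iff[OF nonreal] show False by simp
  qed
  \<comment> \<open>For a core, \<open>M \<i> \<inter> D\<close> is dense in \<open>M \<i>\<close>, so it has no orthogonal vector there but \<open>0\<close>.\<close>
  have dense_if: "dense_in ?D2 UNIV" if "is_core D S ?D2"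
  proof -
    have "M \<i> \<inter> orth_complement (M \<i> \<inter> D) = {0}"
      using that core_iff[OF nonreal]
        dense_in_iff_orthogonal_trivial[OF subspace_MD subspace_M closed_M[OF assms(2)]]
      by (simp add: M_def)
    moreover have "0 \<in> orth_proj (M \<i>) ` dom_adjoint D S"
      unfolding M_def by (rule zero_in_proj_dom_adjoint)
    ultimately show ?thesis
      unfolding dense_iff[OF nonreal] by blast
  qed
  have C1_iff: "C1 z \<longleftrightarrow> dense_in ?D2 UNIV \<and> \<not> is_core D S ?D2" if "z \<notin> \<real>" for z
    unfolding C1_def using nontrivial_iff[OF that] core_iff[OF that] dense_iff[OF that] nontrivial_if
    by blast
  have C2_iff: "C2 z \<longleftrightarrow> nontrivial ?D2 \<and> \<not> dense_in ?D2 UNIV" if "z \<notin> \<real>" for z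
    unfolding C2_def using nontrivial_iff[OF that] core_iff[OF that] dense_iff[OF that] dense_if
    by blast
  show ?thesis
    using C1_iff C2_iff nonreal by blast
qed

end
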